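(* Let $G$ be a finite, simple, connected graph with minimum degree $\delta(G)\geq 2$ that is an interval graph or a circular arc graph. Then $pc(G)\leq 3$. Moreover, this bound is sharp: there exist connected interval graphs and connected circular arc graphs with minimum degree at least $2$ whose proper connection number equals $3$.
   Context: An interval graph is the intersection graph of a family of intervals on the real line (vertices correspond to intervals, adjacent iff the intervals intersect); a circular arc graph is the intersection graph of a family of arcs on a circle. For an edge-colored graph, a path is a proper path if no two consecutive edges of the path receive the same color. An edge-coloring of a connected graph $G$ is a proper-path coloring if every pair of distinct vertices $u,v$ is joined by a proper $u$-$v$ path. The proper connection number $pc(G)$ is the minimum number of colors in a proper-path coloring of $G$. *)

theory Defs
  imports "HOL-Analysis.Analysis" "Graph_Theory.Graph_Theory"
begin

text \<open>
  Finite simple graphs are \<^const>\<open>pair_graph\<close>s: finite, loop-free, symmetric digraphs without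
  parallel arcs. An undirected edge is the two-element set of its ends, so that an edge-coloring
  assigns one color to both orientations.
\<close>

definition edges :: "'a pair_pre_digraph \<Rightarrow> 'a set set" where
  "edges G = (\<lambda>(u, v). {u, v}) ` parcs G"

text \<open>In a symmetric digraph the out-degree of a vertex is its degree as a graph.\<close>

definition min_degree :: "'a pair_pre_digraph \<Rightarrow> nat" where
  "min_degree G = Min (out_degree (with_proj G) ` pverts G)"

definition intersection_graph :: "'a pair_pre_digraph \<Rightarrow> ('a \<Rightarrow> 'b set) \<Rightarrow> bool" where
  "intersection_graph G S \<longleftrightarrow>
     (\<forall>u\<in>pverts G. \<forall>v\<in>pverts G. u \<noteq> v \<longrightarrow> ((u, v) \<in> parcs G \<longleftrightarrow> S u \<inter> S v \<noteq> {}))"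

definition interval_graph :: "'a pair_pre_digraph \<Rightarrow> bool" where
  "interval_graph G \<longleftrightarrow>
     (\<exists>I :: 'a \<Rightarrow> real set.
        (\<forall>v\<in>pverts G. is_interval (I v) \<and> I v \<noteq> {}) \<and> intersection_graph G I)"

text \<open>Arcs of the unit circle; the full circle and single points are included.\<close>

definition circle_arc :: "complex set \<Rightarrow> bool" where
  "circle_arc A \<longleftrightarrow> (\<exists>J :: real set. is_interval J \<and> J \<noteq> {} \<and> A = cis ` J)"

definition circular_arc_graph :: "'a pair_pre_digraph \<Rightarrow> bool" where
  "circular_arc_graph G \<longleftrightarrow>
     (\<exists>A :: 'a \<Rightarrow> complex set. (\<forall>v\<in>pverts G. circle_arc (A v)) \<and> intersection_graph G A)"

definition proper_path :: "'a pair_pre_digraph \<Rightarrow> ('a set \<Rightarrow> 'c) \<Rightarrow> 'a list \<Rightarrow> bool" where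
  "proper_path G c p \<longleftrightarrow>
     vpath p (with_proj G) \<and>
     (\<forall>i. i + 2 < length p \<longrightarrow> c {p ! i, p ! (i + 1)} \<noteq> c {p ! (i + 1), p ! (i + 2)})"

definition proper_path_coloring :: "'a pair_pre_digraph \<Rightarrow> ('a set \<Rightarrow> 'c) \<Rightarrow> bool" where
  "proper_path_coloring G c \<longleftrightarrow>
     (\<forall>u\<in>pverts G. \<forall>v\<in>pverts G. u \<noteq> v \<longrightarrow>
        (\<exists>p. proper_path G c p \<and> hd p = u \<and> last p = v))"

text \<open>
  A finite connected graph has a proper-path coloring (color its edges injectively), so the
  minimum exists; natural numbers suffice as colors because the edge set is finite.
\<close>

definition proper_connection_number :: "'a pair_pre_digraph \<Rightarrow> nat" where
  "proper_connection_number G =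
     (LEAST k. \<exists>c :: 'a set \<Rightarrow> nat. proper_path_coloring G c \<and> card (c ` edges G) = k)"

end

theory Submission
  imports Defs "HOL-Library.Sublist" "HOL-Library.Real_Mod"
begin

text \<open>
  Interval graphs are circular arc graphs, and a connected circular arc graph has a dominating path:
  take a path whose union of arcs contains a maximal set of arcs of the graph. If it misses an arc,
  cut the circle inside that arc; then an arc that sticks out of the union can be attached to an end
  of a subpath with the same union, contradicting maximality.

  Given a dominating path, color its edges alternately with 0 and 1 and the edges that join it to the
  other vertices with 2. This fails only for vertices that are confined, together with all their
  neighbours outside the path, to one path vertex \<open>x\<close>. Choose a maximal independent set among these
  vertices; its members get color 0 on the edge to \<open>x\<close>, the others color 1. Then each of them reaches
  \<open>x\<close> properly with two different final colors.

  For sharpness take at least three triangles sharing a vertex. With two colors, every triangle has a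
  vertex that can enter the hub with one color only, and two of the triangles agree in that color.
\<close>

subsection \<open>Paths and minimum degree\<close>

lemma ex_sublist_between:
  assumes "a \<in> set p" "b \<in> set p"
  shows "\<exists>q. q \<noteq> [] \<and> hd q = a \<and> last q = b \<and> (sublist q p \<or> sublist (rev q) p)"
proof -
  obtain xs ys where p: "p = xs @ a # ys"
    using \<open>a \<in> set p\<close> by (auto dest: split_list)
  consider (after) "b \<in> set (a # ys)" | (before) "b \<in> set xs"
    using \<open>b \<in> set p\<close> p by auto
  then show ?thesis
  proof cases
    case after
    then obtain us vs where split: "a # ys = us @ b # vs"
      by (metis split_list)
    then have "p = xs @ (us @ [b]) @ vs"
      using p by simp
    then have "sublist (us @ [b]) p"
      by (metis sublist_appendI)
    moreover have "hd (us @ [b]) = a"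
      using split by (cases us) auto
    ultimately show ?thesis
      by (intro exI[of _ "us @ [b]"]) simp
  next
    case before
    then obtain us vs where "xs = us @ b # vs"
      by (metis split_list)
    then have "p = us @ rev (a # rev vs @ [b]) @ ys"
      using p by simp
    then have "sublist (rev (a # rev vs @ [b])) p"
      by (metis sublist_appendI)
    then show ?thesis
      by (intro exI[of _ "a # rev vs @ [b]"]) simp
  qed
qed

lemma vpath_with_proj_iff:
  "vpath p (with_proj G) \<longleftrightarrow>
     p \<noteq> [] \<and> distinct p \<and> set p \<subseteq> pverts G \<and> successively (\<lambda>u v. (u, v) \<in> parcs G) p"
proof -
  have "set (vwalk_arcs p) \<subseteq> parcs G \<longleftrightarrow> successively (\<lambda>u v. (u, v) \<in> parcs G) p"
    by (induction p rule: vwalk_arcs.induct) auto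
  then show ?thesis
    by (auto simp: vpath_def vwalk_def)
qed

lemma vpath_sublist:
  assumes "vpath p (with_proj G)" "sublist q p" "q \<noteq> []"
  shows "vpath q (with_proj G)"
  using assms by (auto simp: vpath_with_proj_iff sublist_def successively_append_iff)

lemma out_degree_eq_card: "out_degree (with_proj G) v = card {u. (v, u) \<in> parcs G}"
proof -
  have "out_arcs (with_proj G) v = Pair v ` {u. (v, u) \<in> parcs G}"
    by (auto simp: out_arcs_def)
  then show ?thesis
    by (simp add: out_degree_def card_image inj_on_def)
qed

context pair_graph
begin

lemma parcs_sym: "(u, v) \<in> parcs G \<longleftrightarrow> (v, u) \<in> parcs G"
  using pair_sym_arcs by (auto simp: symmetric_def sym_def)

lemma vpath_rev: "vpath (rev p) (with_proj G) \<longleftrightarrow> vpath p (with_proj G)"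
  using parcs_sym by (auto simp: vpath_with_proj_iff elim!: successively_mono)

lemma finite_edges: "finite (edges G)"
  using pair_finite_arcs by (simp add: edges_def)

lemma ex_crossing_arc:
  assumes "Digraph_Component.connected (with_proj G)"
    and "s \<in> S" "s \<in> pverts G" "t \<in> pverts G" "t \<notin> S"
  obtains u v where "(u, v) \<in> parcs G" "u \<in> S" "v \<notin> S"
proof -
  have "strongly_connected (with_proj G)"
    using assms(1) symmetric_connected_imp_strongly_connected pair_sym_arcs by blast
  then have "(s, t) \<in> (parcs G)\<^sup>*"
    using assms(3,4) reachable_rtranclI[of "with_proj G" s t] by (auto simp: strongly_connected_def)
  then have "\<exists>u v. (u, v) \<in> parcs G \<and> u \<in> S \<and> v \<notin> S"
    using assms(5,2) by (induction rule: converse_rtrancl_induct) auto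
  then show thesis
    using that by blast
qed

lemma connected_if_universal_vertex:
  assumes "z \<in> pverts G" "\<And>v. v \<in> pverts G \<Longrightarrow> v \<noteq> z \<Longrightarrow> (v, z) \<in> parcs G"
  shows "Digraph_Component.connected (with_proj G)"
proof -
  have to_hub: "v \<rightarrow>\<^sup>*\<^bsub>with_proj G\<^esub> z" if "v \<in> pverts G" for v
    using assms that by (cases "v = z") auto
  have from_hub: "z \<rightarrow>\<^sup>*\<^bsub>with_proj G\<^esub> v" if "v \<in> pverts G" for v
    using assms that parcs_sym by (cases "v = z") auto
  have "strongly_connected (with_proj G)"
    using assms(1) to_hub from_hub by (intro strongly_connectedI) (auto intro: reachable_trans)
  then show ?thesis
    by (auto simp: connected_def strongly_connected_def intro: reachable_mk_symmetricI)
qed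

lemma two_le_min_degree_iff:
  assumes "pverts G \<noteq> {}"
  shows "2 \<le> min_degree G \<longleftrightarrow> (\<forall>v\<in>pverts G. \<forall>x. \<exists>u. (v, u) \<in> parcs G \<and> u \<noteq> x)"
proof -
  have "2 \<le> card {u. (v, u) \<in> parcs G} \<longleftrightarrow> (\<forall>x. \<exists>u. (v, u) \<in> parcs G \<and> u \<noteq> x)"
    if "v \<in> pverts G" for v
  proof -
    have "{u. (v, u) \<in> parcs G} \<subseteq> pverts G"
      using arc_snd_in_verts by fastforce
    then have "finite {u. (v, u) \<in> parcs G}"
      using pair_finite_verts finite_subset by blast
    then show ?thesis
      using card_le_Suc0_iff_eq[of "{u. (v, u) \<in> parcs G}"]
      by (simp add: numeral_2_eq_2 not_less_eq_eq[symmetric]) metis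
  qed
  then show ?thesis
    using assms pair_finite_verts by (simp add: min_degree_def out_degree_eq_card)
qed

end

subsection \<open>Arcs of the circle as intervals\<close>

lemma inj_on_cis_open_period: "inj_on cis {\<theta><..<\<theta> + 2 * pi}"
proof (rule inj_onI)
  fix s t
  assume "s \<in> {\<theta><..<\<theta> + 2 * pi}" "t \<in> {\<theta><..<\<theta> + 2 * pi}" "cis s = cis t"
  then show "s = t"
    using exp_complex_eqI[of "\<i> * of_real s" "\<i> * of_real t"] by (auto simp: cis_conv_exp)
qed

lemma ex_angle_in_period:
  obtains x where "cis x = cis r" "\<theta> \<le> x" "x < \<theta> + 2 * pi"
proof
  have "cis (\<theta> + (r - \<theta>) rmod (2 * pi)) = cis \<theta> * cis (r - \<theta>)"
    by (simp only: cis_mult[symmetric] cis_rmod)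
  then show "cis (\<theta> + (r - \<theta>) rmod (2 * pi)) = cis r"
    by (simp add: cis_mult)
  show "\<theta> \<le> \<theta> + (r - \<theta>) rmod (2 * pi)" "\<theta> + (r - \<theta>) rmod (2 * pi) < \<theta> + 2 * pi"
    using rmod_nonneg[of "2 * pi"] rmod_less[of "2 * pi"] by simp_all
qed

lemma circle_arc_lift_through:
  assumes "circle_arc S" "cis x \<in> S"
  obtains J where "is_interval J" "x \<in> J" "S = cis ` J"
proof -
  obtain J :: "real set" where J: "is_interval J" "S = cis ` J"
    using assms(1) by (auto simp: circle_arc_def)
  then obtain r where "r \<in> J" "cis r = cis x"
    using assms(2) by force
  then obtain k :: int where "x = of_int k * (2 * pi) + r"
    by (auto simp: cis_eq_iff rcong_altdef add.commute)
  then have "x \<in> (\<lambda>t. of_int k * (2 * pi) + t) ` J"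
    using \<open>r \<in> J\<close> by blast
  moreover have "cis (of_int k * (2 * pi) + t) = cis t" for t
    by (auto simp: cis_eq_iff rcong_altdef intro!: exI[of _ "- k"])
  then have "S = cis ` (\<lambda>t. of_int k * (2 * pi) + t) ` J"
    by (simp add: J(2) image_image)
  ultimately show thesis
    using J(1) by (intro that) auto
qed

lemma circle_arc_lift:
  assumes "circle_arc S" "cis \<theta> \<notin> S"
  obtains B where "is_interval B" "B \<subseteq> {\<theta><..<\<theta> + 2 * pi}" "S = cis ` B"
proof -
  obtain r where "cis r \<in> S"
    using assms(1) by (auto simp: circle_arc_def)
  obtain x where x: "cis x = cis r" "\<theta> \<le> x" "x < \<theta> + 2 * pi"
    by (rule ex_angle_in_period)
  then obtain B where B: "is_interval B" "x \<in> B" "S = cis ` B"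
    using circle_arc_lift_through[OF assms(1)] \<open>cis r \<in> S\<close> by metis
  have "cis (\<theta> + 2 * pi) = cis \<theta>"
    by (simp add: cis_mult[symmetric])
  then have cuts: "\<theta> \<notin> B" "\<theta> + 2 * pi \<notin> B"
    using assms(2) B(3) by (metis imageI)+
  have "\<theta> < t" "t < \<theta> + 2 * pi" if "t \<in> B" for t
    using mem_is_interval_1_I[OF B(1) that B(2), of \<theta>]
      mem_is_interval_1_I[OF B(1,2) that, of "\<theta> + 2 * pi"] cuts x(2,3) by linarith+
  then show thesis
    using B by (intro that) auto
qed

lemma circle_arc_covers_side:
  assumes S: "circle_arc S" "\<not> S \<subseteq> cis ` U" and U: "is_interval U" and x: "x \<in> U" "cis x \<in> S"
  shows "(\<forall>y\<in>U. y \<le> x \<longrightarrow> cis y \<in> S) \<or> (\<forall>y\<in>U. x \<le> y \<longrightarrow> cis y \<in> S)"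
proof -
  obtain J where J: "is_interval J" "x \<in> J" "S = cis ` J"
    using circle_arc_lift_through[OF S(1) x(2)] .
  obtain s where s: "s \<in> J" "s \<notin> U"
    using S(2) J(3) by blast
  show ?thesis
  proof (cases "s \<le> x")
    case True
    then have "s \<le> y" if "y \<in> U" for y
      using mem_is_interval_1_I[OF U that x(1), of s] s(2) by linarith
    then have "y \<in> J" if "y \<in> U" "y \<le> x" for y
      using mem_is_interval_1_I[OF J(1) s(1) J(2)] that by blast
    then show ?thesis
      using J(3) by blast
  next
    case False
    then have "y \<le> s" if "y \<in> U" for y
      using mem_is_interval_1_I[OF U x(1) that, of s] s(2) by linarith
    then have "y \<in> J" if "y \<in> U" "x \<le> y" for y
      using mem_is_interval_1_I[OF J(1,2) s(1)] that by blast
    then show ?thesis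
      using J(3) by blast
  qed
qed

lemma interval_graph_imp_circular_arc_graph:
  assumes "interval_graph G"
  shows "circular_arc_graph G"
proof -
  obtain I :: "'a \<Rightarrow> real set"
    where I: "\<And>v. v \<in> pverts G \<Longrightarrow> is_interval (I v) \<and> I v \<noteq> {}" and G: "intersection_graph G I"
    using assms by (auto simp: interval_graph_def)
  have "arctan x \<in> {- pi<..<- pi + 2 * pi}" for x
    using arctan_bounded[of x] pi_gt_zero by simp
  then have "range arctan \<subseteq> {- pi<..<- pi + 2 * pi}"
    by blast
  then have "inj (cis \<circ> arctan)"
    using inj_on_cis_open_period[of "- pi"]
    by (intro comp_inj_on) (auto simp: inj_def arctan_eq_iff intro: inj_on_subset)
  then have "intersection_graph G (\<lambda>v. (cis \<circ> arctan) ` I v)"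
    using G by (simp only: intersection_graph_def image_Int[symmetric] image_is_empty)
  moreover have "circle_arc ((cis \<circ> arctan) ` I v)" if "v \<in> pverts G" for v
  proof -
    have "is_interval (arctan ` I v)"
      using I[OF that]
      by (auto simp: is_interval_connected_1 intro!: connected_continuous_image continuous_intros)
    then show ?thesis
      using I[OF that] unfolding circle_arc_def image_comp[symmetric] by blast
  qed
  ultimately show ?thesis
    unfolding circular_arc_graph_def by (intro exI[of _ "\<lambda>v. (cis \<circ> arctan) ` I v"]) simp
qed

subsection \<open>Dominating paths of circular arc graphs\<close>

lemma (in linorder) ex_cofinal_member:
  assumes "finite F" "F \<noteq> {}"
  shows "\<exists>m\<in>F. \<forall>x\<in>(\<Union>v\<in>F. B v). \<exists>y\<in>B m. x \<le> y"
proof (rule ccontr)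
  assume "\<not> ?thesis"
  then obtain f where f: "\<And>m. m \<in> F \<Longrightarrow> f m \<in> (\<Union>v\<in>F. B v)"
      "\<And>m y. m \<in> F \<Longrightarrow> y \<in> B m \<Longrightarrow> y < f m"
    by (metis not_le)
  have "Max (f ` F) \<in> f ` F"
    using assms by (intro Max_in) auto
  then obtain m where m: "m \<in> F" "Max (f ` F) = f m"
    by blast
  then obtain v where "v \<in> F" "f m < f v"
    using f by blast
  then show False
    using Max_ge[of "f ` F" "f v"] assms(1) m(2) by simp
qed

lemmas ex_coinitial_member = linorder.ex_cofinal_member[OF linorder_class.dual_linorder]

lemma is_interval_Union_chain:
  fixes B :: "'b \<Rightarrow> real set"
  assumes "successively (\<lambda>u v. B u \<inter> B v \<noteq> {}) p" "\<And>v. v \<in> set p \<Longrightarrow> is_interval (B v)"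
  shows "is_interval (\<Union>v\<in>set p. B v)"
  using assms
proof (induction p rule: induct_list012)
  case (3 u v p)
  have "is_interval (B u)" "is_interval (\<Union>v\<in>set (v # p). B v)"
    using 3 by auto
  moreover have "B u \<inter> (\<Union>v\<in>set (v # p). B v) \<noteq> {}"
    using 3 by auto
  ultimately have "is_interval (B u \<union> (\<Union>v\<in>set (v # p). B v))"
    unfolding is_interval_connected_1 by (rule connected_Un)
  then show ?case
    by simp
qed auto

lemma (in pair_graph) ex_extremal_subpath:
  fixes B :: "'a \<Rightarrow> real set"
  assumes p: "vpath p (with_proj G)"
    and interval: "\<And>v. v \<in> set p \<Longrightarrow> is_interval (B v)"
    and meet: "\<And>u v. u \<in> set p \<Longrightarrow> v \<in> set p \<Longrightarrow> (u, v) \<in> parcs G \<Longrightarrow> B u \<inter> B v \<noteq> {}"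
  obtains q where "vpath q (with_proj G)" "set q \<subseteq> set p" "(\<Union>v\<in>set q. B v) = (\<Union>v\<in>set p. B v)"
    "\<forall>x\<in>\<Union>v\<in>set p. B v. \<exists>y\<in>B (hd q). y \<le> x" "\<forall>x\<in>\<Union>v\<in>set p. B v. \<exists>y\<in>B (last q). x \<le> y"
proof -
  have "set p \<noteq> {}"
    using p by (auto simp: vpath_with_proj_iff)
  then obtain a b where a: "a \<in> set p" "\<forall>x\<in>\<Union>v\<in>set p. B v. \<exists>y\<in>B a. y \<le> x"
    and b: "b \<in> set p" "\<forall>x\<in>\<Union>v\<in>set p. B v. \<exists>y\<in>B b. x \<le> y"
    using ex_coinitial_member[of "set p" B] ex_cofinal_member[of "set p" B] by blast
  obtain q where q: "q \<noteq> []" "hd q = a" "last q = b" "sublist q p \<or> sublist (rev q) p"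
    using ex_sublist_between[OF a(1) b(1)] by blast
  then have q_path: "vpath q (with_proj G)"
    using vpath_sublist[OF p, of q] vpath_sublist[OF p, of "rev q"] vpath_rev[of q] by auto
  have q_sub: "set q \<subseteq> set p"
    using q(4) set_mono_sublist by fastforce
  have "successively (\<lambda>u v. (u, v) \<in> parcs G) q"
    using q_path by (simp add: vpath_with_proj_iff)
  then have "successively (\<lambda>u v. B u \<inter> B v \<noteq> {}) q"
    by (rule successively_mono) (use meet q_sub in blast)
  then have "is_interval (\<Union>v\<in>set q. B v)"
    using interval q_sub by (intro is_interval_Union_chain) auto
  moreover have "B a \<subseteq> (\<Union>v\<in>set q. B v)" "B b \<subseteq> (\<Union>v\<in>set q. B v)"
    using q(1-3) hd_in_set last_in_set by blast+
  ultimately have "x \<in> (\<Union>v\<in>set q. B v)" if "x \<in> (\<Union>v\<in>set p. B v)" for x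
    using bspec[OF a(2) that] bspec[OF b(2) that] mem_is_interval_1_I[of "\<Union>v\<in>set q. B v"]
    by (meson subsetD)
  then have "(\<Union>v\<in>set q. B v) = (\<Union>v\<in>set p. B v)"
    using q_sub by blast
  then show thesis
    using a(2) b(2) q(2,3) q_path q_sub by (intro that[of q]) simp_all
qed

definition dominating_path :: "'a pair_pre_digraph \<Rightarrow> 'a list \<Rightarrow> bool" where
  "dominating_path G p \<longleftrightarrow>
     vpath p (with_proj G) \<and> (\<forall>v\<in>pverts G. v \<notin> set p \<longrightarrow> (\<exists>x\<in>set p. (v, x) \<in> parcs G))"

locale circular_arc_representation = pair_graph +
  fixes A :: "'a \<Rightarrow> complex set"
  assumes circle_arc: "\<And>v. v \<in> pverts G \<Longrightarrow> circle_arc (A v)"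
    and representation: "intersection_graph G A"
begin

definition sweep :: "'a list \<Rightarrow> complex set" where
  "sweep p = (\<Union>v\<in>set p. A v)"

definition covered :: "'a list \<Rightarrow> 'a set" where
  "covered p = {v \<in> pverts G. A v \<subseteq> sweep p}"

lemma parcs_iff_meet:
  "u \<in> pverts G \<Longrightarrow> v \<in> pverts G \<Longrightarrow> u \<noteq> v \<Longrightarrow> (u, v) \<in> parcs G \<longleftrightarrow> A u \<inter> A v \<noteq> {}"
  using representation by (simp add: intersection_graph_def)

lemma ex_lift_of_path:
  assumes p: "vpath p (with_proj G)" and cut: "cis \<theta> \<notin> sweep p"
  obtains B where "\<And>v. v \<in> set p \<Longrightarrow> is_interval (B v)" "\<And>v. v \<in> set p \<Longrightarrow> A v = cis ` B v"
    "\<And>u v. u \<in> set p \<Longrightarrow> v \<in> set p \<Longrightarrow> (u, v) \<in> parcs G \<Longrightarrow> B u \<inter> B v \<noteq> {}"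
proof -
  have p_verts: "set p \<subseteq> pverts G"
    using p by (simp add: vpath_with_proj_iff)
  have "\<exists>B. is_interval B \<and> B \<subseteq> {\<theta><..<\<theta> + 2 * pi} \<and> A v = cis ` B" if "v \<in> set p" for v
  proof -
    have "circle_arc (A v)" "cis \<theta> \<notin> A v"
      using circle_arc cut p_verts that by (auto simp: sweep_def)
    then show ?thesis
      by (metis circle_arc_lift)
  qed
  then obtain B where B: "\<And>v. v \<in> set p \<Longrightarrow> is_interval (B v)" "\<And>v. v \<in> set p \<Longrightarrow> A v = cis ` B v"
    and period: "\<And>v. v \<in> set p \<Longrightarrow> B v \<subseteq> {\<theta><..<\<theta> + 2 * pi}"
    by metis
  have "B u \<inter> B v \<noteq> {}" if uv: "u \<in> set p" "v \<in> set p" "(u, v) \<in> parcs G" for u v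
  proof -
    have "u \<noteq> v"
      using uv(3) pair_no_loops by fastforce
    then have "A u \<inter> A v \<noteq> {}"
      using uv p_verts parcs_iff_meet by blast
    then have "cis ` (B u \<inter> B v) \<noteq> {}"
      using inj_on_image_Int[OF inj_on_cis_open_period period period] B(2) uv by simp
    then show ?thesis
      by blast
  qed
  then show thesis
    using that B by blast
qed

lemma ex_path_same_sweep_adjacent_hd:
  assumes p: "vpath p (with_proj G)" and cut: "cis \<theta> \<notin> sweep p"
    and w: "w \<in> pverts G" "A w \<inter> sweep p \<noteq> {}" "\<not> A w \<subseteq> sweep p"
  obtains q where "vpath q (with_proj G)" "set q \<subseteq> set p" "sweep q = sweep p" "(w, hd q) \<in> parcs G"
proof -
  obtain B where B: "\<And>v. v \<in> set p \<Longrightarrow> is_interval (B v)" "\<And>v. v \<in> set p \<Longrightarrow> A v = cis ` B v"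
    "\<And>u v. u \<in> set p \<Longrightarrow> v \<in> set p \<Longrightarrow> (u, v) \<in> parcs G \<Longrightarrow> B u \<inter> B v \<noteq> {}"
    using ex_lift_of_path[OF p cut] by blast
  define U where "U = (\<Union>v\<in>set p. B v)"
  obtain q where q: "vpath q (with_proj G)" "set q \<subseteq> set p" "(\<Union>v\<in>set q. B v) = U"
    and first: "\<forall>x\<in>U. \<exists>y\<in>B (hd q). y \<le> x" and final: "\<forall>x\<in>U. \<exists>y\<in>B (last q). x \<le> y"
    using ex_extremal_subpath[OF p B(1,3)] unfolding U_def .
  have "sweep r = cis ` (\<Union>v\<in>set r. B v)" if "set r \<subseteq> set p" for r
    using B(2) that by (fastforce simp: sweep_def)
  then have sweep: "sweep p = cis ` U" "sweep q = cis ` U"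
    using q(2,3) U_def by simp_all
  have "successively (\<lambda>u v. B u \<inter> B v \<noteq> {}) p"
    using p B(3) by (auto simp: vpath_with_proj_iff elim!: successively_mono)
  then have "is_interval U"
    unfolding U_def using B(1) by (rule is_interval_Union_chain)
  obtain x where x: "x \<in> U" "cis x \<in> A w"
    using w(2) sweep(1) by auto
  have side: "(\<forall>y\<in>U. y \<le> x \<longrightarrow> cis y \<in> A w) \<or> (\<forall>y\<in>U. x \<le> y \<longrightarrow> cis y \<in> A w)"
    using circle_arc_covers_side circle_arc[OF w(1)] w(3) sweep(1) \<open>is_interval U\<close> x by simp
  have "q \<noteq> []"
    using q(1) by (simp add: vpath_with_proj_iff)
  then have ends: "hd q \<in> set q" "last q \<in> set q"
    by simp_all
  then have "B (hd q) \<subseteq> U" "B (last q) \<subseteq> U"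
    using q(3) by blast+
  then have "A w \<inter> A (hd q) \<noteq> {} \<or> A w \<inter> A (last q) \<noteq> {}"
    using side bspec[OF first x(1)] bspec[OF final x(1)] B(2) ends q(2) by blast
  moreover have "set p \<subseteq> pverts G" "w \<notin> set p"
    using p w(3) by (auto simp: vpath_with_proj_iff sweep_def)
  ultimately have "(w, hd q) \<in> parcs G \<or> (w, hd (rev q)) \<in> parcs G"
    using parcs_iff_meet[OF w(1)] ends q(2) by (auto simp: hd_rev)
  then show thesis
    using that[of q] that[of "rev q"] q(1,2) sweep vpath_rev by (auto simp: sweep_def)
qed

lemma ex_extended_path:
  assumes p: "vpath p (with_proj G)" and cut: "cis \<theta> \<notin> sweep p"
    and w: "w \<in> pverts G" "A w \<inter> sweep p \<noteq> {}" "\<not> A w \<subseteq> sweep p"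
  obtains p' where "vpath p' (with_proj G)" "sweep p' = A w \<union> sweep p"
proof -
  obtain q where q: "vpath q (with_proj G)" "set q \<subseteq> set p" "sweep q = sweep p" "(w, hd q) \<in> parcs G"
    using ex_path_same_sweep_adjacent_hd[OF assms] .
  moreover have "w \<notin> set q"
    using q(2) w(3) by (auto simp: sweep_def)
  ultimately have "vpath (w # q) (with_proj G)"
    using w(1) by (auto simp: vpath_with_proj_iff successively_Cons)
  moreover have "sweep (w # q) = A w \<union> sweep p"
    using q(3) by (simp add: sweep_def)
  ultimately show thesis
    by (rule that)
qed

lemma ex_better_covering_path:
  assumes conn: "Digraph_Component.connected (with_proj G)" and p: "vpath p (with_proj G)"
    and v: "v \<in> pverts G" "A v \<inter> sweep p = {}"
  obtains p' where "vpath p' (with_proj G)" "covered p \<subset> covered p'"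
proof -
  obtain \<theta> where \<theta>: "cis \<theta> \<in> A v"
    using circle_arc[OF v(1)] by (auto simp: circle_arc_def)
  then have "v \<notin> covered p"
    using v(2) by (auto simp: covered_def)
  moreover have "hd p \<in> set p" "hd p \<in> pverts G"
    using p by (auto simp: vpath_with_proj_iff)
  then have "hd p \<in> covered p" "hd p \<in> pverts G"
    unfolding covered_def sweep_def by blast+
  ultimately obtain s w where sw: "(s, w) \<in> parcs G" "s \<in> covered p" "w \<notin> covered p"
    using ex_crossing_arc[OF conn] v(1) by metis
  then have w: "w \<in> pverts G" "\<not> A w \<subseteq> sweep p"
    using arc_snd_in_verts by (force simp: covered_def)+
  have "A s \<inter> A w \<noteq> {}"
    using sw w(1) parcs_iff_meet[of s w] by (auto simp: covered_def)
  then have "A w \<inter> sweep p \<noteq> {}"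
    using sw(2) by (auto simp: covered_def)
  moreover have "cis \<theta> \<notin> sweep p"
    using \<theta> v(2) by blast
  ultimately obtain p' where p': "vpath p' (with_proj G)" "sweep p' = A w \<union> sweep p"
    using ex_extended_path[OF p _ w(1)] w(2) by blast
  then have "covered p \<subseteq> covered p'" "w \<in> covered p'"
    using w(1) by (auto simp: covered_def)
  then show thesis
    using that p'(1) sw(3) by blast
qed

lemma ex_dominating_path:
  assumes conn: "Digraph_Component.connected (with_proj G)"
  obtains p where "dominating_path G p"
proof -
  define \<C> where "\<C> = covered ` {p. vpath p (with_proj G)}"
  have "\<C> \<subseteq> Pow (pverts G)"
    by (auto simp: \<C>_def covered_def)
  then have "finite \<C>"
    using pair_finite_verts finite_subset by blast
  moreover obtain v where "v \<in> pverts G"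
    using conn by (auto simp: connected_conv)
  then have "vpath [v] (with_proj G)"
    by (simp add: vpath_with_proj_iff)
  then have "\<C> \<noteq> {}"
    by (auto simp: \<C>_def)
  ultimately obtain p where p: "vpath p (with_proj G)"
    and maximal: "\<And>q. vpath q (with_proj G) \<Longrightarrow> \<not> covered p \<subset> covered q"
    using finite_has_maximal[of \<C>] unfolding \<C>_def by blast
  have "\<exists>x\<in>set p. (v, x) \<in> parcs G" if v: "v \<in> pverts G" "v \<notin> set p" for v
  proof (rule ccontr)
    assume "\<not> (\<exists>x\<in>set p. (v, x) \<in> parcs G)"
    moreover have "set p \<subseteq> pverts G"
      using p by (simp add: vpath_with_proj_iff)
    ultimately have "A v \<inter> sweep p = {}"
      using v parcs_iff_meet[OF v(1)] unfolding sweep_def by blast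
    then show False
      using ex_better_covering_path[OF conn p v(1)] maximal by blast
  qed
  then show thesis
    using that p by (auto simp: dominating_path_def)
qed

end

theorem (in pair_graph) circular_arc_graph_imp_ex_dominating_path:
  assumes "circular_arc_graph G" "Digraph_Component.connected (with_proj G)"
  obtains p where "dominating_path G p"
proof -
  obtain A where "\<forall>v\<in>pverts G. circle_arc (A v)" "intersection_graph G A"
    using assms(1) by (auto simp: circular_arc_graph_def)
  then interpret circular_arc_representation G A
    by unfold_locales auto
  show thesis
    using ex_dominating_path[OF assms(2)] that by blast
qed

subsection \<open>Properly colored paths\<close>

fun properly_colored :: "('a set \<Rightarrow> 'c) \<Rightarrow> 'a list \<Rightarrow> bool" where
  "properly_colored c (x # y # z # p) \<longleftrightarrow> c {x, y} \<noteq> c {y, z} \<and> properly_colored c (y # z # p)"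
| "properly_colored c _ \<longleftrightarrow> True"

lemma properly_colored_conv_nth:
  "properly_colored c p \<longleftrightarrow>
     (\<forall>i. i + 2 < length p \<longrightarrow> c {p ! i, p ! (i + 1)} \<noteq> c {p ! (i + 1), p ! (i + 2)})"
proof (induction c p rule: properly_colored.induct)
  case (1 c x y z p)
  show ?case (is "_ \<longleftrightarrow> (\<forall>i. ?changes i)")
  proof -
    have "(\<forall>i. ?changes i) \<longleftrightarrow> ?changes 0 \<and> (\<forall>i. ?changes (Suc i))"
      by (metis not0_implies_Suc)
    then show ?thesis
      using 1 by simp
  qed
qed auto

lemma properly_colored_append_iff:
  "properly_colored c (xs @ x # ys) \<longleftrightarrow>
     properly_colored c (xs @ [x]) \<and> properly_colored c (x # ys) \<and>
     (xs \<noteq> [] \<longrightarrow> ys \<noteq> [] \<longrightarrow> c {last xs, x} \<noteq> c {x, hd ys})"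
proof (induction xs rule: induct_list012)
  case (2 a)
  then show ?case
    by (cases ys) auto
next
  case (3 a b xs)
  then show ?case
    by (cases xs) auto
qed simp

lemma properly_colored_rev: "properly_colored c (rev p) \<longleftrightarrow> properly_colored c p"
proof (induction c p rule: properly_colored.induct)
  case (1 c x y z p)
  then show ?case
    using properly_colored_append_iff[of c "rev p @ [z]" y "[x]"] by (auto simp: insert_commute)
qed auto

lemma proper_path_iff:
  "proper_path G c p \<longleftrightarrow> vpath p (with_proj G) \<and> properly_colored c p"
  by (simp add: proper_path_def properly_colored_conv_nth)

lemma proper_path_sublist:
  assumes p: "proper_path G c p" and q: "sublist q p" "q \<noteq> []"
  shows "proper_path G c q"
proof -
  obtain xs ys where split: "p = xs @ q @ ys"
    using q(1) by (auto simp: sublist_def)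
  have "c {q ! i, q ! (i + 1)} \<noteq> c {q ! (i + 1), q ! (i + 2)}" if "i + 2 < length q" for i
    using p that unfolding proper_path_def split
    by (auto simp: nth_append dest: spec[of _ "length xs + i"])
  then show ?thesis
    using p q vpath_sublist by (auto simp: proper_path_def)
qed

definition alternating :: "'a list \<Rightarrow> 'a set \<Rightarrow> nat" where
  "alternating p e = (LEAST i. p ! i \<in> e) mod 2"

lemma alternating_less: "alternating p e < 2"
  by (simp add: alternating_def)

lemma alternating_path_edge:
  assumes "distinct p" "i + 1 < length p"
  shows "alternating p {p ! i, p ! (i + 1)} = i mod 2"
proof -
  have "(LEAST j. p ! j \<in> {p ! i, p ! (i + 1)}) = i"
  proof (rule Least_equality)
    fix j
    assume "p ! j \<in> {p ! i, p ! (i + 1)}"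
    then show "i \<le> j"
      using assms nth_eq_iff_index_eq[of p j i] nth_eq_iff_index_eq[of p j "i + 1"] by fastforce
  qed simp
  then show ?thesis
    by (simp add: alternating_def)
qed

lemma properly_colored_alternating:
  assumes "distinct p"
  shows "properly_colored (alternating p) p"
  unfolding properly_colored_conv_nth
proof (intro allI impI)
  fix i
  assume "i + 2 < length p"
  then have "alternating p {p ! i, p ! (i + 1)} = i mod 2"
    "alternating p {p ! (i + 1), p ! (i + 2)} = (i + 1) mod 2"
    using alternating_path_edge[OF assms, of i] alternating_path_edge[OF assms, of "i + 1"]
    by (simp_all add: numeral_2_eq_2)
  then show "alternating p {p ! i, p ! (i + 1)} \<noteq> alternating p {p ! (i + 1), p ! (i + 2)}"
    by presburger
qed

context pair_graph
begin

lemma proper_path_rev: "proper_path G c (rev p) \<longleftrightarrow> proper_path G c p"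
  by (simp add: proper_path_iff vpath_rev properly_colored_rev)

lemma proper_path_join:
  assumes "proper_path G c (h @ [x])" "proper_path G c (x # q)" "set h \<inter> set q = {}"
    and "h \<noteq> [] \<Longrightarrow> q \<noteq> [] \<Longrightarrow> c {last h, x} \<noteq> c {x, hd q}"
  shows "proper_path G c (h @ x # q)"
proof -
  have "vpath (h @ x # q) (with_proj G)"
    using assms(1-3) by (auto simp: proper_path_iff vpath_with_proj_iff successively_append_iff)
  moreover have "properly_colored c (h @ x # q)"
    using assms unfolding properly_colored_append_iff[of c h x q] proper_path_iff by blast
  ultimately show ?thesis
    by (simp add: proper_path_iff)
qed

lemma proper_path_arc:
  assumes "(u, v) \<in> parcs G"
  shows "proper_path G c [u, v]"
  using assms pair_no_loops[of "(u, v)"] arc_fst_in_verts[of "(u, v)"] arc_snd_in_verts[of "(u, v)"]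
  by (auto simp: proper_path_iff vpath_with_proj_iff)

definition linked :: "('a set \<Rightarrow> 'c) \<Rightarrow> 'a \<Rightarrow> 'a \<Rightarrow> bool" where
  "linked c u v \<longleftrightarrow> (\<exists>p. proper_path G c p \<and> hd p = u \<and> last p = v)"

lemma linkedI: "proper_path G c p \<Longrightarrow> hd p = u \<Longrightarrow> last p = v \<Longrightarrow> linked c u v"
  by (auto simp: linked_def)

lemma linked_sym: "linked c u v \<Longrightarrow> linked c v u"
  unfolding linked_def by (metis proper_path_rev hd_rev last_rev)

lemma linked_arc: "(u, v) \<in> parcs G \<Longrightarrow> linked c u v"
  by (rule linkedI[OF proper_path_arc]) auto

end

lemma proper_connection_number_le:
  fixes c :: "'a set \<Rightarrow> nat"
  assumes "proper_path_coloring G c" "\<And>e. e \<in> edges G \<Longrightarrow> c e < k"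
  shows "proper_connection_number G \<le> k"
proof -
  have "proper_connection_number G \<le> card (c ` edges G)"
    unfolding proper_connection_number_def by (rule Least_le) (use assms(1) in blast)
  also have "\<dots> \<le> card {..<k}"
    using assms(2) by (intro card_mono) auto
  finally show ?thesis
    by simp
qed

lemma ex_optimal_proper_path_coloring:
  fixes c :: "'a set \<Rightarrow> nat"
  assumes "proper_path_coloring G c"
  obtains c' :: "'a set \<Rightarrow> nat"
    where "proper_path_coloring G c'" "card (c' ` edges G) = proper_connection_number G"
proof -
  have "\<exists>c' :: 'a set \<Rightarrow> nat.
      proper_path_coloring G c' \<and> card (c' ` edges G) = proper_connection_number G"
    unfolding proper_connection_number_def by (rule LeastI_ex) (use assms in blast)
  then show thesis
    using that by blast
qed

subsection \<open>Three colors suffice around a dominating path\<close>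

lemma ex_maximal_independent_set:
  assumes "finite T" "\<And>u v. R u v \<Longrightarrow> R v u" "\<And>u. \<not> R u u"
  obtains I where "I \<subseteq> T" "\<And>u v. u \<in> I \<Longrightarrow> v \<in> I \<Longrightarrow> \<not> R u v"
    "\<And>u. u \<in> T \<Longrightarrow> u \<notin> I \<Longrightarrow> \<exists>v\<in>I. R u v"
proof -
  define \<I> where "\<I> = {I. I \<subseteq> T \<and> (\<forall>u\<in>I. \<forall>v\<in>I. \<not> R u v)}"
  have "finite \<I>" "\<I> \<noteq> {}"
    using assms(1) by (auto simp: \<I>_def)
  then obtain I where I: "I \<in> \<I>" "\<And>J. J \<in> \<I> \<Longrightarrow> I \<subseteq> J \<Longrightarrow> J = I"
    using finite_has_maximal[of \<I>] by metis
  have "\<exists>v\<in>I. R u v" if "u \<in> T" "u \<notin> I" for u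
  proof (rule ccontr)
    assume "\<not> (\<exists>v\<in>I. R u v)"
    then have "insert u I \<in> \<I>"
      using I(1) that(1) assms(2,3) by (auto simp: \<I>_def)
    then show False
      using I(2) that(2) by blast
  qed
  then show thesis
    using that[of I] I(1) by (auto simp: \<I>_def)
qed

locale dominated_pair_graph = pair_graph +
  fixes P :: "'a list"
  assumes dominating: "dominating_path G P"
    and two_le_min_degree: "2 \<le> min_degree G"
begin

definition outer :: "'a set" where
  "outer = pverts G - set P"

definition contacts :: "'a \<Rightarrow> 'a set" where
  "contacts u = {x \<in> set P. (u, x) \<in> parcs G}"

text \<open>
  For an outer vertex that is not captive, contact edges of a single color suffice: it reaches \<open>P\<close> at
  two different vertices, possibly through an outer neighbour. A captive vertex reaches \<open>P\<close> in one
  vertex only, and must therefore be able to arrive there with two different colors.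
\<close>

definition captive :: "'a set" where
  "captive = {u \<in> outer. (\<exists>x. contacts u = {x}) \<and>
     (\<forall>v\<in>outer. (u, v) \<in> parcs G \<longrightarrow> contacts v = contacts u)}"

lemma captive_outer: "captive \<subseteq> outer"
  by (auto simp: captive_def)

lemma outer_disjoint_path: "outer \<inter> set P = {}"
  by (auto simp: outer_def)

lemma contacts_subset_path: "contacts u \<subseteq> set P"
  by (auto simp: contacts_def)

lemma contacts_nonempty: "u \<in> outer \<Longrightarrow> contacts u \<noteq> {}"
  using dominating by (auto simp: outer_def contacts_def dominating_path_def)

lemma ex_second_neighbour:
  assumes "v \<in> pverts G"
  obtains u where "(v, u) \<in> parcs G" "u \<noteq> x"
  using two_le_min_degree_iff two_le_min_degree assms by blast

end

locale colored_dominated_pair_graph = dominated_pair_graph +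
  fixes I :: "'a set"
  assumes I_captive: "I \<subseteq> captive"
    and I_independent: "\<And>u v. u \<in> I \<Longrightarrow> v \<in> I \<Longrightarrow> (u, v) \<notin> parcs G"
    and I_maximal: "\<And>u. u \<in> captive \<Longrightarrow> u \<notin> I \<Longrightarrow> \<exists>v\<in>I. (u, v) \<in> parcs G"
begin

text \<open>
  Edges outside the path get the color that differs from the contact edge to be taken next: 2 between
  captive vertices, whose contact edges have color 0 or 1, and 0 towards a vertex that is not captive.
\<close>

definition color :: "'a set \<Rightarrow> nat" where
  "color e =
     (if e \<subseteq> set P then alternating P e
      else if e \<inter> set P \<noteq> {} then
        if e \<inter> captive = {} then 2 else if e \<inter> I \<noteq> {} then 0 else 1
      else if e \<subseteq> captive then 2 else 0)"

lemma color_less: "color e < 3"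
  using alternating_less[of P e] by (simp add: color_def)

lemma color_path: "e \<subseteq> set P \<Longrightarrow> color e = alternating P e"
  by (simp add: color_def)

lemma color_contact:
  assumes "u \<in> outer" "x \<in> set P"
  shows "color {u, x} = (if u \<notin> captive then 2 else if u \<in> I then 0 else 1)"
proof -
  have "u \<notin> set P" "x \<notin> captive" "x \<notin> I"
    using assms captive_outer outer_disjoint_path I_captive by auto
  then show ?thesis
    using assms(2) by (auto simp: color_def)
qed

lemma color_outer:
  assumes "u \<in> outer" "v \<in> outer"
  shows "color {u, v} = (if u \<in> captive \<and> v \<in> captive then 2 else 0)"
  using assms by (auto simp: color_def outer_def)

lemma proper_path_dominating: "proper_path G color P"
proof -
  have "distinct P"
    using dominating by (simp add: dominating_path_def vpath_with_proj_iff)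
  moreover have "color {P ! i, P ! j} = alternating P {P ! i, P ! j}"
    if "i < length P" "j < length P" for i j
    using that by (intro color_path) simp
  ultimately have "properly_colored color P"
    using properly_colored_alternating[of P] by (simp add: properly_colored_conv_nth)
  then show ?thesis
    using dominating by (simp add: proper_path_iff dominating_path_def)
qed

definition segment :: "'a \<Rightarrow> 'a list \<Rightarrow> 'a \<Rightarrow> bool" where
  "segment x q y \<longleftrightarrow> proper_path G color (x # q @ [y]) \<and> set (x # q @ [y]) \<subseteq> set P"

lemma ex_segment:
  assumes "x \<in> set P" "y \<in> set P" "x \<noteq> y"
  obtains q where "segment x q y"
proof -
  obtain r where r: "r \<noteq> []" "hd r = x" "last r = y" "sublist r P \<or> sublist (rev r) P"
    using ex_sublist_between[OF assms(1,2)] by blast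
  then have "proper_path G color r"
    using proper_path_sublist[OF proper_path_dominating] proper_path_rev[of color r] by auto
  moreover have "set r \<subseteq> set P"
    using r(4) set_mono_sublist by fastforce
  moreover have "r = x # butlast (tl r) @ [y]"
    using r(1-3) assms(3) by (cases r) (auto split: if_splits)
  ultimately show thesis
    by (metis segment_def that)
qed

lemma segment_end_colors:
  assumes "segment x q y"
  shows "color {x, hd (q @ [y])} < 2" "color {last (x # q), y} < 2"
proof -
  have "{x, hd (q @ [y])} \<subseteq> set P" "{last (x # q), y} \<subseteq> set P"
    using assms by (cases q; auto simp: segment_def split: if_splits)+
  then show "color {x, hd (q @ [y])} < 2" "color {last (x # q), y} < 2"
    using alternating_less by (simp_all only: color_path)
qed

definition hook :: "'a \<Rightarrow> 'a \<Rightarrow> 'a \<Rightarrow> bool" where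
  "hook u v x \<longleftrightarrow> u \<in> outer \<and> v \<in> outer \<and> x \<in> contacts v \<and>
     (v = u \<or> (u, v) \<in> parcs G \<and> color {u, v} \<noteq> color {v, x})"

definition hook_path :: "'a \<Rightarrow> 'a \<Rightarrow> 'a list" where
  "hook_path u v = (if v = u then [u] else [u, v])"

lemma hook_path_simps:
  "set (hook_path u v) = {u, v}" "hd (hook_path u v) = u" "last (hook_path u v) = v"
  "hook_path u v \<noteq> []"
  by (auto simp: hook_path_def)

lemma hook_end: "hook u v x \<Longrightarrow> x \<in> set P"
  using contacts_subset_path by (auto simp: hook_def)

lemma hook_self: "u \<in> outer \<Longrightarrow> x \<in> contacts u \<Longrightarrow> hook u u x"
  by (simp add: hook_def)

lemma proper_path_hook:
  assumes "hook u v x"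
  shows "proper_path G color (hook_path u v @ [x])"
proof -
  have arc: "(v, x) \<in> parcs G" and "u \<noteq> x"
    using assms by (auto simp: hook_def contacts_def outer_def)
  show ?thesis
  proof (cases "v = u")
    case True
    then show ?thesis
      using arc proper_path_arc by (simp add: hook_path_def)
  next
    case False
    then have "(u, v) \<in> parcs G" "color {u, v} \<noteq> color {v, x}"
      using assms by (auto simp: hook_def)
    then have "proper_path G color ([u] @ v # [x])"
      using arc \<open>u \<noteq> x\<close> by - (rule proper_path_join, simp_all add: proper_path_arc)
    then show ?thesis
      using False by (simp add: hook_path_def)
  qed
qed

lemma hooks_disjoint:
  assumes "hook u v x" "hook w z y" "u \<noteq> w" "(u, w) \<notin> parcs G" "v \<noteq> z"
  shows "{u, v} \<inter> {w, z} = {}"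
  using assms parcs_sym by (auto simp: hook_def)

lemma linked_hooks_same_end:
  assumes h: "hook u v x" and k: "hook w z x" and nonadjacent: "u \<noteq> w" "(u, w) \<notin> parcs G"
    and "color {v, x} \<noteq> color {z, x}"
  shows "linked color u w"
proof -
  have "proper_path G color (hook_path u v @ x # rev (hook_path w z))"
  proof (rule proper_path_join)
    show "proper_path G color (x # rev (hook_path w z))"
      using proper_path_hook[OF k] proper_path_rev[of color "hook_path w z @ [x]"] by simp
    show "set (hook_path u v) \<inter> set (rev (hook_path w z)) = {}"
      using hooks_disjoint[OF h k nonadjacent] assms(5) by (auto simp: hook_path_simps)
  qed (use proper_path_hook[OF h] assms(5) in \<open>simp_all add: hook_path_simps hd_rev insert_commute\<close>)
  then show ?thesis
    by (rule linkedI) (simp_all add: hook_path_simps last_rev)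
qed

lemma proper_path_hook_segment:
  assumes "segment x q y" "hook u v x" "color {v, x} \<noteq> color {x, hd (q @ [y])}"
  shows "proper_path G color (hook_path u v @ x # q @ [y])"
proof (rule proper_path_join)
  show "set (hook_path u v) \<inter> set (q @ [y]) = {}"
    using assms(1,2) outer_disjoint_path by (auto simp: segment_def hook_path_simps hook_def)
qed (use assms proper_path_hook in \<open>simp_all add: segment_def hook_path_simps\<close>)

lemma linked_hook_segment:
  assumes "segment x q y" "hook u v x" "color {v, x} \<noteq> color {x, hd (q @ [y])}"
  shows "linked color u y"
  using proper_path_hook_segment[OF assms] by (rule linkedI) (simp_all add: hook_path_simps)

lemma linked_hooks:
  assumes q: "segment x q y"
    and h: "hook u v x" "color {v, x} \<noteq> color {x, hd (q @ [y])}"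
    and k: "hook w z y" "color {z, y} \<noteq> color {last (x # q), y}"
    and nonadjacent: "u \<noteq> w" "(u, w) \<notin> parcs G" and "v \<noteq> z"
  shows "linked color u w"
proof -
  have "proper_path G color ((hook_path u v @ x # q) @ y # rev (hook_path w z))"
  proof (rule proper_path_join)
    show "proper_path G color ((hook_path u v @ x # q) @ [y])"
      using proper_path_hook_segment[OF q h] by simp
    show "proper_path G color (y # rev (hook_path w z))"
      using proper_path_hook[OF k(1)] proper_path_rev[of color "hook_path w z @ [y]"] by simp
    have "{w, z} \<inter> set P = {}"
      using k(1) outer_disjoint_path by (auto simp: hook_def)
    then show "set (hook_path u v @ x # q) \<inter> set (rev (hook_path w z)) = {}"
      using hooks_disjoint[OF h(1) k(1) nonadjacent \<open>v \<noteq> z\<close>] q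
      by (auto simp: hook_path_simps segment_def)
  qed (use k(2) in \<open>auto simp: hook_path_simps hd_rev insert_commute\<close>)
  then show ?thesis
    by (rule linkedI) (simp_all add: hook_path_simps last_rev)
qed

lemma ex_free_hook:
  assumes u: "u \<in> outer" "u \<notin> captive"
  obtains v x where "hook u v x" "x \<noteq> y" "color {v, x} = 2"
proof (cases "contacts u = {y}")
  case False
  then obtain x where x: "x \<in> contacts u" "x \<noteq> y"
    using contacts_nonempty[OF u(1)] by blast
  then have "color {u, x} = 2"
    using u contacts_subset_path color_contact[of u x] by auto
  then show thesis
    using that x hook_self[OF u(1)] by blast
next
  case True
  then obtain v where v: "v \<in> outer" "(u, v) \<in> parcs G" "contacts v \<noteq> {y}"
    using u by (auto simp: captive_def)
  then obtain x where x: "x \<in> contacts v" "x \<noteq> y"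
    using contacts_nonempty by blast
  have "v \<notin> captive"
    using True v u(1) parcs_sym by (auto simp: captive_def)
  then have "color {v, x} = 2" "color {u, v} = 0"
    using v u x(1) by (simp_all add: color_contact color_outer contacts_def)
  then show thesis
    using x v u(1) by (intro that[of v x]) (auto simp: hook_def)
qed

lemma captive_hook_contacts:
  assumes "hook u v x" "u \<in> captive"
  shows "contacts v = contacts u"
  using assms by (auto simp: hook_def captive_def)

lemma ex_differently_colored_neighbour:
  assumes u: "u \<in> captive" "contacts u = {x}"
  obtains v where "v \<in> outer" "(u, v) \<in> parcs G" "color {v, x} \<noteq> color {u, x}" "color {u, v} \<noteq> color {v, x}"
proof -
  have u_outer: "u \<in> outer" and x: "x \<in> set P"
    using u captive_outer contacts_subset_path by auto
  obtain w where w: "(u, w) \<in> parcs G" "w \<noteq> x"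
    using ex_second_neighbour[of u x] u_outer by (auto simp: outer_def)
  then have w_outer: "w \<in> outer"
    using u(2) arc_snd_in_verts[OF w(1)] by (auto simp: outer_def contacts_def)
  show thesis
  proof (cases "w \<in> captive")
    case False
    then show thesis
      using w w_outer u(1) u_outer x by (intro that[of w]) (auto simp: color_contact color_outer)
  next
    case True
    then obtain v where "v \<in> captive" "(u, v) \<in> parcs G" "v \<in> I \<longleftrightarrow> u \<notin> I"
      using I_independent I_maximal[OF u(1)] I_captive w(1) by blast
    then show thesis
      using u(1) u_outer x captive_outer by (intro that[of v]) (auto simp: color_contact color_outer)
  qed
qed

lemma ex_captive_hook:
  assumes u: "u \<in> captive" "contacts u = {x}"
  obtains v where "hook u v x" "color {v, x} \<noteq> \<alpha>"
proof (cases "color {u, x} = \<alpha>")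
  case False
  then show thesis
    using u captive_outer hook_self[of u x] by (intro that[of u]) auto
next
  case True
  obtain v where v: "v \<in> outer" "(u, v) \<in> parcs G" "color {v, x} \<noteq> color {u, x}" "color {u, v} \<noteq> color {v, x}"
    using ex_differently_colored_neighbour[OF u] .
  then have "contacts v = {x}"
    using u by (auto simp: captive_def)
  then have "hook u v x"
    using v u captive_outer by (auto simp: hook_def)
  then show thesis
    using that v(3) True by simp
qed

lemma linked_path_path:
  assumes "x \<in> set P" "y \<in> set P" "x \<noteq> y"
  shows "linked color x y"
proof -
  obtain q where "segment x q y"
    using ex_segment[OF assms] .
  then have "proper_path G color (x # q @ [y])"
    by (simp add: segment_def)
  then show ?thesis
    by (rule linkedI) simp_all
qed

lemma linked_outer_path:
  assumes u: "u \<in> outer" and y: "y \<in> set P" and nonadjacent: "(u, y) \<notin> parcs G"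
  shows "linked color u y"
proof (cases "u \<in> captive")
  case False
  obtain v x where h: "hook u v x" "x \<noteq> y" "color {v, x} = 2"
    using ex_free_hook[OF u False] .
  obtain q where q: "segment x q y"
    using ex_segment[OF hook_end[OF h(1)] y h(2)] .
  show ?thesis
    using linked_hook_segment[OF q h(1)] h(3) segment_end_colors(1)[OF q] by simp
next
  case True
  then obtain x where x: "contacts u = {x}"
    by (auto simp: captive_def)
  then have "x \<in> set P" "x \<noteq> y"
    using nonadjacent by (auto simp: contacts_def)
  then obtain q where q: "segment x q y"
    using ex_segment y by blast
  obtain v where "hook u v x" "color {v, x} \<noteq> color {x, hd (q @ [y])}"
    using ex_captive_hook[OF True x] .
  then show ?thesis
    by (rule linked_hook_segment[OF q])
qed

lemma linked_free_free:
  assumes u: "u \<in> outer" "u \<notin> captive" and w: "w \<in> outer" "w \<notin> captive"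
    and nonadjacent: "u \<noteq> w" "(u, w) \<notin> parcs G"
  shows "linked color u w"
proof -
  obtain y where "y \<in> contacts w"
    using contacts_nonempty[OF w(1)] by blast
  then have k: "hook w w y" "color {w, y} = 2"
    using w contacts_subset_path[of w] hook_self color_contact[of w y] by auto
  obtain v x where h: "hook u v x" "x \<noteq> y" "color {v, x} = 2"
    using ex_free_hook[OF u] .
  then have "v \<noteq> w"
    using nonadjacent by (auto simp: hook_def)
  obtain q where q: "segment x q y"
    using ex_segment[OF hook_end[OF h(1)] hook_end[OF k(1)] h(2)] .
  show ?thesis
    using linked_hooks[OF q h(1) _ k(1) _ nonadjacent \<open>v \<noteq> w\<close>] segment_end_colors[OF q] h(3) k(2)
    by simp
qed

lemma linked_captive_free:
  assumes u: "u \<in> captive" and w: "w \<in> outer" "w \<notin> captive"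
    and nonadjacent: "u \<noteq> w" "(u, w) \<notin> parcs G"
  shows "linked color u w"
proof -
  obtain x where x: "contacts u = {x}"
    using u by (auto simp: captive_def)
  then have "x \<in> set P"
    using contacts_subset_path by blast
  obtain z y where k: "hook w z y" "y \<noteq> x" "color {z, y} = 2"
    using ex_free_hook[OF w] .
  obtain q where q: "segment x q y"
    using ex_segment[OF \<open>x \<in> set P\<close> hook_end[OF k(1)] k(2)[symmetric]] .
  obtain v where h: "hook u v x" "color {v, x} \<noteq> color {x, hd (q @ [y])}"
    using ex_captive_hook[OF u x] .
  have "contacts v = {x}" "y \<in> contacts z"
    using captive_hook_contacts[OF h(1) u] x k(1) by (simp_all add: hook_def)
  then have "v \<noteq> z"
    using k(2) by auto
  then show ?thesis
    using linked_hooks[OF q h k(1) _ nonadjacent] k(3) segment_end_colors(2)[OF q] by simp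
qed

lemma linked_captive_captive:
  assumes u: "u \<in> captive" and w: "w \<in> captive" and nonadjacent: "u \<noteq> w" "(u, w) \<notin> parcs G"
  shows "linked color u w"
proof -
  obtain x where x: "contacts u = {x}"
    using u by (auto simp: captive_def)
  obtain y where y: "contacts w = {y}"
    using w by (auto simp: captive_def)
  show ?thesis
  proof (cases "x = y")
    case True
    then have k: "hook w w x"
      using w y captive_outer by (intro hook_self) auto
    obtain v where "hook u v x" "color {v, x} \<noteq> color {w, x}"
      using ex_captive_hook[OF u x] .
    then show ?thesis
      using linked_hooks_same_end[OF _ k nonadjacent] by simp
  next
    case False
    have "x \<in> set P" "y \<in> set P"
      using x y contacts_subset_path by blast+
    then obtain q where q: "segment x q y"
      using ex_segment False by blast
    obtain v where h: "hook u v x" "color {v, x} \<noteq> color {x, hd (q @ [y])}"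
      using ex_captive_hook[OF u x] .
    obtain z where k: "hook w z y" "color {z, y} \<noteq> color {last (x # q), y}"
      using ex_captive_hook[OF w y] .
    have "v \<noteq> z"
      using captive_hook_contacts[OF h(1) u] captive_hook_contacts[OF k(1) w] x y False by auto
    then show ?thesis
      by (rule linked_hooks[OF q h k nonadjacent])
  qed
qed

lemma proper_path_coloring_color: "proper_path_coloring G color"
proof -
  have "linked color u w" if uw: "u \<in> pverts G" "w \<in> pverts G" "u \<noteq> w" for u w
  proof (cases "(u, w) \<in> parcs G")
    case True
    then show ?thesis
      by (rule linked_arc)
  next
    case False
    then have "(w, u) \<notin> parcs G"
      using parcs_sym by blast
    moreover have "u \<in> outer \<or> u \<in> set P" "w \<in> outer \<or> w \<in> set P"
      using uw(1,2) by (auto simp: outer_def)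
    ultimately show ?thesis
      using False uw(3) linked_path_path linked_outer_path linked_free_free linked_captive_free
        linked_captive_captive linked_sym
      by metis
  qed
  then show ?thesis
    by (auto simp: proper_path_coloring_def linked_def)
qed

end

theorem (in pair_graph) dominating_path_imp_ex_three_coloring:
  assumes "dominating_path G P" "2 \<le> min_degree G"
  obtains c :: "'a set \<Rightarrow> nat" where "\<And>e. c e < 3" "proper_path_coloring G c"
proof -
  interpret dominated_pair_graph G P
    using assms by unfold_locales
  have "finite captive"
    using pair_finite_verts by (rule rev_finite_subset) (auto simp: captive_def outer_def)
  then obtain I where I: "I \<subseteq> captive" "\<And>u v. u \<in> I \<Longrightarrow> v \<in> I \<Longrightarrow> (u, v) \<notin> parcs G"
    "\<And>u. u \<in> captive \<Longrightarrow> u \<notin> I \<Longrightarrow> \<exists>v\<in>I. (u, v) \<in> parcs G"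
    using ex_maximal_independent_set[of captive "\<lambda>u v. (u, v) \<in> parcs G"] parcs_sym
      pair_no_loops[of "(u, u)" for u] by (metis fst_conv snd_conv)
  interpret colored_dominated_pair_graph G P I
    by unfold_locales (fact I)+
  show thesis
    using that[of color] color_less proper_path_coloring_color by blast
qed

theorem (in pair_graph) circular_arc_graph_imp_ex_three_coloring:
  assumes "circular_arc_graph G" "Digraph_Component.connected (with_proj G)" "2 \<le> min_degree G"
  obtains c :: "'a set \<Rightarrow> nat" where "\<And>e. c e < 3" "proper_path_coloring G c"
  using circular_arc_graph_imp_ex_dominating_path[OF assms(1,2)]
    dominating_path_imp_ex_three_coloring[OF _ assms(3)] by metis

subsection \<open>Friendship graphs\<close>

definition entry_colors ::
  "'a pair_pre_digraph \<Rightarrow> ('a set \<Rightarrow> 'c) \<Rightarrow> 'a \<Rightarrow> 'a \<Rightarrow> 'c set" where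
  "entry_colors G c z u = {c {last h, z} | h. h \<noteq> [] \<and> hd h = u \<and> proper_path G c (h @ [z])}"

lemma (in pair_graph) proper_path_through_entry_colors:
  assumes p: "proper_path G c p" "z \<in> set p" "hd p \<noteq> z" "last p \<noteq> z"
  obtains a b where "a \<in> entry_colors G c z (hd p)" "b \<in> entry_colors G c z (last p)" "a \<noteq> b"
proof -
  obtain h q where split: "p = h @ z # q"
    using p(2) by (auto dest: split_list)
  have ne: "h \<noteq> []" "q \<noteq> []"
    using split p(3,4) by auto
  have "proper_path G c (h @ [z])"
    using proper_path_sublist[OF p(1), of "h @ [z]"] sublist_append_rightI[of "h @ [z]" q] split
    by simp
  then have "c {last h, z} \<in> entry_colors G c z (hd p)"
    using ne(1) split by (auto simp: entry_colors_def)
  moreover have "proper_path G c (rev q @ [z])"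
    using proper_path_sublist[OF p(1), of "z # q"] proper_path_rev[of c "z # q"] split by simp
  then have "c {last (rev q), z} \<in> entry_colors G c z (last p)"
    using ne(2) split by (force simp: entry_colors_def hd_rev)
  moreover have "c {last h, z} \<noteq> c {last (rev q), z}"
    using p(1) ne properly_colored_append_iff[of c h z q]
    by (simp add: proper_path_iff split last_rev insert_commute)
  ultimately show thesis
    by (rule that)
qed

text \<open>Truncated subtraction makes the hub \<open>0\<close> its own mate.\<close>

definition mate :: "nat \<Rightarrow> nat" where
  "mate v = (if odd v then v + 1 else v - 1)"

lemma mate_triangle: "mate (2 * i + 1) = 2 * i + 2" "mate (2 * i + 2) = 2 * i + 1"
  by (simp_all add: mate_def)

lemma nonzero_triangle_cases:
  fixes v :: nat
  assumes "v \<noteq> 0"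
  obtains i where "v = 2 * i + 1 \<or> v = 2 * i + 2"
proof -
  have "\<exists>i. v = 2 * i + 1 \<or> v = 2 * i + 2"
    using assms by presburger
  then show thesis
    using that by blast
qed

lemma mate_mate: "mate (mate v) = v"
  by (auto simp: mate_def)

lemma mate_eq_self_iff: "mate v = v \<longleftrightarrow> v = 0"
  unfolding mate_def by presburger

lemma mate_eq_0_iff: "mate v = 0 \<longleftrightarrow> v = 0"
  by (metis mate_mate mate_eq_self_iff)

lemma mate_le_even: "v \<le> 2 * n \<Longrightarrow> mate v \<le> 2 * n"
  unfolding mate_def by presburger

definition friendship_graph :: "nat \<Rightarrow> nat pair_pre_digraph" where
  "friendship_graph n = \<lparr> pverts = {..2 * n},
     parcs = {(u, v). u \<le> 2 * n \<and> v \<le> 2 * n \<and> u \<noteq> v \<and> (u = 0 \<or> v = 0 \<or> v = mate u)} \<rparr>"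

lemma pverts_friendship_graph: "pverts (friendship_graph n) = {..2 * n}"
  by (simp add: friendship_graph_def)

lemma parcs_friendship_graph_iff:
  "(u, v) \<in> parcs (friendship_graph n) \<longleftrightarrow>
     u \<le> 2 * n \<and> v \<le> 2 * n \<and> u \<noteq> v \<and> (u = 0 \<or> v = 0 \<or> v = mate u)"
  by (simp add: friendship_graph_def)

lemma parcs_friendship_graph_hub:
  "v \<noteq> 0 \<Longrightarrow> v \<le> 2 * n \<Longrightarrow> (v, 0) \<in> parcs (friendship_graph n)"
  by (simp add: parcs_friendship_graph_iff)

lemma parcs_friendship_graph_mate:
  "v \<noteq> 0 \<Longrightarrow> v \<le> 2 * n \<Longrightarrow> (v, mate v) \<in> parcs (friendship_graph n)"
  using mate_le_even[of v n] mate_eq_self_iff[of v] by (auto simp: parcs_friendship_graph_iff)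

lemma pair_graph_friendship_graph: "pair_graph (friendship_graph n)"
proof
  have "parcs (friendship_graph n) \<subseteq> {..2 * n} \<times> {..2 * n}"
    by (auto simp: friendship_graph_def)
  then show "finite (parcs (friendship_graph n))"
    by (rule finite_subset) auto
qed (auto simp: friendship_graph_def symmetric_def sym_def mate_mate)

interpretation friendship: pair_graph "friendship_graph n" for n
  by (rule pair_graph_friendship_graph)

lemma connected_friendship_graph: "Digraph_Component.connected (with_proj (friendship_graph n))"
  by (rule friendship.connected_if_universal_vertex[of 0])
    (simp_all add: pverts_friendship_graph parcs_friendship_graph_hub)

lemma min_degree_friendship_graph:
  assumes "n \<ge> 1"
  shows "min_degree (friendship_graph n) \<ge> 2"
proof -
  have "\<exists>u. (v, u) \<in> parcs (friendship_graph n) \<and> u \<noteq> x" if "v \<le> 2 * n" for v x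
  proof (cases "v = 0")
    case True
    then have "(v, 1) \<in> parcs (friendship_graph n)" "(v, 2) \<in> parcs (friendship_graph n)"
      using assms by (auto simp: parcs_friendship_graph_iff)
    then show ?thesis
      by (cases "x = 1") auto
  next
    case False
    then show ?thesis
      using that parcs_friendship_graph_hub parcs_friendship_graph_mate mate_eq_0_iff by metis
  qed
  then show ?thesis
    by (simp add: friendship.two_le_min_degree_iff pverts_friendship_graph)
qed

lemma interval_graph_friendship_graph: "interval_graph (friendship_graph n)"
proof -
  define I :: "nat \<Rightarrow> real set" where "I v = (if v = 0 then UNIV else {real ((v + 1) div 2)})" for v
  have same_triangle: "v = mate u \<longleftrightarrow> (v + 1) div 2 = (u + 1) div 2"
    if nonzero: "u \<noteq> 0" "v \<noteq> 0" and "u \<noteq> v" for u v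
  proof -
    obtain i j where "u = 2 * i + 1 \<or> u = 2 * i + 2" "v = 2 * j + 1 \<or> v = 2 * j + 2"
      using nonzero_triangle_cases nonzero by metis
    then show ?thesis
      using \<open>u \<noteq> v\<close> mate_triangle[of i] by auto
  qed
  have "intersection_graph (friendship_graph n) I"
    unfolding intersection_graph_def
  proof (intro ballI impI)
    fix u v
    assume "u \<in> pverts (friendship_graph n)" "v \<in> pverts (friendship_graph n)" "u \<noteq> v"
    then show "(u, v) \<in> parcs (friendship_graph n) \<longleftrightarrow> I u \<inter> I v \<noteq> {}"
      using same_triangle[of u v]
      by (simp add: pverts_friendship_graph parcs_friendship_graph_iff I_def)
  qed
  moreover have "is_interval (I v) \<and> I v \<noteq> {}" for v
    by (simp add: I_def is_interval_1)
  ultimately show ?thesis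
    unfolding interval_graph_def by blast
qed

lemma friendship_graph_hub_free_path:
  assumes "vpath p (with_proj (friendship_graph n))" "0 \<notin> set p"
  shows "p = [hd p] \<or> p = [hd p, mate (hd p)]"
proof -
  have "successively (\<lambda>u v. (u, v) \<in> parcs (friendship_graph n)) p" "distinct p" "p \<noteq> []"
    using assms(1) by (auto simp: vpath_with_proj_iff)
  then have chain: "successively (\<lambda>u v. v = mate u) p"
    by - (erule successively_mono, use assms(2) in \<open>auto simp: parcs_friendship_graph_iff\<close>)
  obtain u q where p: "p = u # q"
    using \<open>p \<noteq> []\<close> by (cases p) auto
  show ?thesis
  proof (cases q)
    case Nil
    then show ?thesis
      using p by simp
  next
    case (Cons v r)
    then have "v = mate u"
      using chain p by simp
    moreover have "r = []"
    proof (rule ccontr)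
      assume "r \<noteq> []"
      then have "hd r = u"
        using chain p Cons by (cases r) (auto simp: mate_mate)
      then show False
        using \<open>distinct p\<close> \<open>r \<noteq> []\<close> p Cons by auto
    qed
    ultimately show ?thesis
      using p Cons by simp
  qed
qed

lemma entry_colors_friendship_graph:
  "entry_colors (friendship_graph n) c 0 u \<subseteq>
     insert (c {u, 0}) (if c {u, mate u} = c {mate u, 0} then {} else {c {mate u, 0}})"
proof
  fix a
  assume "a \<in> entry_colors (friendship_graph n) c 0 u"
  then obtain h where h: "a = c {last h, 0}" "h \<noteq> []" "hd h = u"
    and proper: "proper_path (friendship_graph n) c (h @ [0])"
    by (auto simp: entry_colors_def)
  have "vpath h (with_proj (friendship_graph n))" "0 \<notin> set h"
    using proper h(2) by (auto simp: proper_path_iff vpath_with_proj_iff successively_append_iff)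
  then have "h = [u] \<or> h = [u, mate u]"
    using friendship_graph_hub_free_path h(3) by blast
  then show "a \<in> insert (c {u, 0}) (if c {u, mate u} = c {mate u, 0} then {} else {c {mate u, 0}})"
    using h(1) proper by (auto simp: proper_path_iff)
qed

lemma ex_single_entry_color:
  assumes colors: "card (c ` edges (friendship_graph n)) \<le> 2" and u: "u \<noteq> 0" "u \<le> 2 * n"
  obtains v \<gamma> where "v \<in> {u, mate u}" "\<gamma> \<in> c ` edges (friendship_graph n)"
    "entry_colors (friendship_graph n) c 0 v \<subseteq> {\<gamma>}"
proof -
  let ?C = "c ` edges (friendship_graph n)"
  have "finite ?C"
    using friendship.finite_edges by simp
  have in_C: "c {a, b} \<in> ?C" if "(a, b) \<in> parcs (friendship_graph n)" for a b
    using that by (force simp: edges_def)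
  have triangle_colors: "c {u, 0} \<in> ?C" "c {mate u, 0} \<in> ?C" "c {u, mate u} \<in> ?C"
    using u parcs_friendship_graph_hub[of _ n] parcs_friendship_graph_mate[of u n] mate_le_even
    by (auto intro!: in_C simp: mate_eq_0_iff simp del: neq0_conv)
  have "card {c {u, 0}, c {mate u, 0}, c {u, mate u}} \<le> 2"
    using card_mono[OF \<open>finite ?C\<close>, of "{c {u, 0}, c {mate u, 0}, c {u, mate u}}"] triangle_colors colors
    by simp
  then consider (single_at_u) "c {u, 0} = c {mate u, 0} \<or> c {u, mate u} = c {mate u, 0}"
    | (single_at_mate) "c {u, mate u} = c {u, 0}"
    by (auto simp: card_insert_if split: if_splits)
  then show thesis
  proof cases
    case single_at_u
    then have "entry_colors (friendship_graph n) c 0 u \<subseteq> {c {u, 0}}"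
      using entry_colors_friendship_graph[of n c u] by (auto split: if_splits)
    then show thesis
      using that[of u] triangle_colors(1) by simp
  next
    case single_at_mate
    then have "entry_colors (friendship_graph n) c 0 (mate u) \<subseteq> {c {mate u, 0}}"
      using entry_colors_friendship_graph[of n c "mate u"] by (simp add: mate_mate insert_commute)
    then show thesis
      using that[of "mate u"] triangle_colors(2) by simp
  qed
qed

lemma friendship_graph_distinct_entry_colors:
  assumes c: "proper_path_coloring (friendship_graph n) c"
    and uv: "u \<in> {1..2 * n}" "v \<in> {1..2 * n}" "v \<noteq> u" "v \<noteq> mate u"
  obtains a b where "a \<in> entry_colors (friendship_graph n) c 0 u"
    "b \<in> entry_colors (friendship_graph n) c 0 v" "a \<noteq> b"
proof -
  have "u \<in> pverts (friendship_graph n)" "v \<in> pverts (friendship_graph n)"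
    using uv(1,2) by (simp_all add: pverts_friendship_graph)
  then obtain p where p: "proper_path (friendship_graph n) c p" "hd p = u" "last p = v"
    using c uv(3) unfolding proper_path_coloring_def by metis
  have "0 \<in> set p"
  proof (rule ccontr)
    assume "0 \<notin> set p"
    then have "p = [u] \<or> p = [u, mate u]"
      using friendship_graph_hub_free_path p(1,2) by (auto simp: proper_path_iff)
    then show False
      using p(3) uv(3,4) by auto
  qed
  then show thesis
    using friendship.proper_path_through_entry_colors[OF p(1)] p(2,3) uv(1,2) that
    by (metis atLeastAtMost_iff not_one_le_zero)
qed

lemma card_colors_friendship_graph:
  assumes c: "proper_path_coloring (friendship_graph n) c" and "n \<ge> 3"
  shows "card (c ` edges (friendship_graph n)) > 2"
proof (rule ccontr)
  let ?C = "c ` edges (friendship_graph n)"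
  assume "\<not> card ?C > 2"
  then have colors: "card ?C \<le> 2"
    by simp
  have "\<exists>v \<gamma>. v \<in> {2 * i + 1, 2 * i + 2} \<and> \<gamma> \<in> ?C \<and>
      entry_colors (friendship_graph n) c 0 v \<subseteq> {\<gamma>}" if "i < n" for i
  proof -
    have "2 * i + 1 \<noteq> 0" "2 * i + 1 \<le> 2 * n"
      using that by simp_all
    then show ?thesis
      using ex_single_entry_color[OF colors] mate_triangle(1) by metis
  qed
  then obtain v \<gamma> where v: "\<And>i. i < n \<Longrightarrow> v i \<in> {2 * i + 1, 2 * i + 2}"
    and \<gamma>: "\<And>i. i < n \<Longrightarrow> \<gamma> i \<in> ?C"
      "\<And>i. i < n \<Longrightarrow> entry_colors (friendship_graph n) c 0 (v i) \<subseteq> {\<gamma> i}"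
    by metis
  have "\<gamma> i \<noteq> \<gamma> j" if "i < n" "j < n" "i \<noteq> j" for i j
  proof -
    have "v i \<in> {1..2 * n}" "v j \<in> {1..2 * n}" "v j \<noteq> v i" "v j \<noteq> mate (v i)"
      using v[of i] v[of j] that mate_triangle[of i] by auto
    then obtain a b where "a \<in> entry_colors (friendship_graph n) c 0 (v i)"
      "b \<in> entry_colors (friendship_graph n) c 0 (v j)" "a \<noteq> b"
      by (rule friendship_graph_distinct_entry_colors[OF c])
    then show ?thesis
      using \<gamma>(2)[OF that(1)] \<gamma>(2)[OF that(2)] by auto
  qed
  then have "inj_on \<gamma> {..<n}"
    by (auto intro!: inj_onI)
  moreover have "finite ?C"
    using friendship.finite_edges by simp
  ultimately have "n \<le> card ?C"
    using card_inj_on_le[of \<gamma> "{..<n}" ?C] \<gamma>(1) by auto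
  then show False
    using colors \<open>n \<ge> 3\<close> by simp
qed

theorem proper_connection_number_friendship_graph:
  assumes "n \<ge> 3"
  shows "proper_connection_number (friendship_graph n) = 3"
proof (rule antisym)
  have "min_degree (friendship_graph n) \<ge> 2"
    using assms by (intro min_degree_friendship_graph) simp
  then obtain c :: "nat set \<Rightarrow> nat"
    where c: "\<And>e. c e < 3" "proper_path_coloring (friendship_graph n) c"
    using friendship.circular_arc_graph_imp_ex_three_coloring connected_friendship_graph
      interval_graph_imp_circular_arc_graph[OF interval_graph_friendship_graph] by metis
  then show "proper_connection_number (friendship_graph n) \<le> 3"
    by (intro proper_connection_number_le)
  show "3 \<le> proper_connection_number (friendship_graph n)"
    using ex_optimal_proper_path_coloring[OF c(2)] card_colors_friendship_graph[OF _ assms]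
    by (metis Suc_leI numeral_3_eq_3 numeral_2_eq_2)
qed

theorem theorem4p2:
  shows "(\<forall>G :: 'a pair_pre_digraph.
            pair_graph G \<and> Digraph_Component.connected (with_proj G) \<and> min_degree G \<ge> 2 \<and>
            (interval_graph G \<or> circular_arc_graph G)
            \<longrightarrow> proper_connection_number G \<le> 3) \<and>
         (\<exists>G :: nat pair_pre_digraph.
            pair_graph G \<and> Digraph_Component.connected (with_proj G) \<and> min_degree G \<ge> 2 \<and>
            interval_graph G \<and> proper_connection_number G = 3) \<and>
         (\<exists>G :: nat pair_pre_digraph.
            pair_graph G \<and> Digraph_Component.connected (with_proj G) \<and> min_degree G \<ge> 2 \<and>
            circular_arc_graph G \<and> proper_connection_number G = 3)"
proof (intro conjI allI impI)
  fix G :: "'a pair_pre_digraph"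
  assume G: "pair_graph G \<and> Digraph_Component.connected (with_proj G) \<and> min_degree G \<ge> 2 \<and>
    (interval_graph G \<or> circular_arc_graph G)"
  then obtain c :: "'a set \<Rightarrow> nat" where "\<And>e. c e < 3" "proper_path_coloring G c"
    using pair_graph.circular_arc_graph_imp_ex_three_coloring interval_graph_imp_circular_arc_graph
    by metis
  then show "proper_connection_number G \<le> 3"
    by (intro proper_connection_number_le)
next
  have sharp: "pair_graph (friendship_graph 3)"
    "Digraph_Component.connected (with_proj (friendship_graph 3))"
    "min_degree (friendship_graph 3) \<ge> 2" "interval_graph (friendship_graph 3)"
    "proper_connection_number (friendship_graph 3) = 3"
    by (simp_all add: pair_graph_friendship_graph connected_friendship_graph
        min_degree_friendship_graph interval_graph_friendship_graph
        proper_connection_number_friendship_graph)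
  then show "\<exists>G :: nat pair_pre_digraph.
      pair_graph G \<and> Digraph_Component.connected (with_proj G) \<and> min_degree G \<ge> 2 \<and>
      interval_graph G \<and> proper_connection_number G = 3"
    by blast
  show "\<exists>G :: nat pair_pre_digraph.
      pair_graph G \<and> Digraph_Component.connected (with_proj G) \<and> min_degree G \<ge> 2 \<and>
      circular_arc_graph G \<and> proper_connection_number G = 3"
    using sharp interval_graph_imp_circular_arc_graph by blast
qed

end
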